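(* Let $\mathcal F$ be a class of probability densities on $\mathbb{R}^d$ with the property that for every $f\in\mathcal F$ satisfying $\int\|x\|^2f(x)\,\mathrm{d}x<\infty$ there exists a sequence $(g_m)_{m\ge1}\subset\mathcal M$ such that (a) $f(x)/g_m(x)\to1$ for $F$-almost every $x$, and (b) the family $\{L_m\}_{m\ge1}$, $L_m=\log_+(f/g_m)$, is uniformly integrable under $F$. Then for every $f\in\mathcal F$, $$\inf_{g\in\mathcal M}\mathrm{KL}(f\|g)=0\iff\int_{\mathbb{R}^d}\|x\|^2f(x)\,\mathrm{d}x<\infty.$$
   Context: All densities are with respect to Lebesgue measure; for a density $f$, $F(A)=\int_Af\,\mathrm{d}x$. $\mathrm{KL}(f\|g)=\int f\log(f/g)\,\mathrm{d}x\in[0,\infty]$ with $0\log(0/\cdot)=0$. $\log_+t=\max\{\log t,0\}$ for $t>0$, $\log_+0=0$. A family $(X_m)$ of nonnegative random variables is uniformly integrable under $F$ if $\lim_{M\to\infty}\sup_m\int_{\{X_m>M\}}X_m\,\mathrm{d}F=0$. $\mathcal M$ denotes the class of all finite Gaussian mixture densities on $\mathbb{R}^d$: $x\mapsto\sum_{j=1}^m\pi_j\varphi(x;\mu_j,\Sigma_j)$ with $m\in\mathbb N$, $\pi_j\ge0$, $\sum_j\pi_j=1$, $\mu_j\in\mathbb{R}^d$, $\Sigma_j\succ0$, $\varphi(\cdot;\mu,\Sigma)$ the $N(\mu,\Sigma)$ density. *)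

theory Defs
  imports "HOL-Probability.Probability"
begin

definition prob_density :: "(real^'n \<Rightarrow> real) \<Rightarrow> bool" where
  "prob_density f \<longleftrightarrow> f \<in> borel_measurable lborel \<and> (\<forall>x. 0 \<le> f x)
     \<and> (\<integral>\<^sup>+ x. ennreal (f x) \<partial>lborel) = 1"

definition pos_def_mat :: "real^'n^'n \<Rightarrow> bool" where
  "pos_def_mat S \<longleftrightarrow> transpose S = S \<and> (\<forall>x. x \<noteq> 0 \<longrightarrow> 0 < x \<bullet> (S *v x))"

definition gauss_density :: "real^'n \<Rightarrow> real^'n^'n \<Rightarrow> real^'n \<Rightarrow> real" where
  "gauss_density mu S x =
     exp (- (1/2) * ((x - mu) \<bullet> (matrix_inv S *v (x - mu))))
       / sqrt ((2 * pi) ^ CARD('n) * det S)"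

definition is_gmm :: "(real^'n \<Rightarrow> real) \<Rightarrow> bool" where
  "is_gmm g \<longleftrightarrow> (\<exists>(m::nat) (w::nat \<Rightarrow> real) (mu::nat \<Rightarrow> real^'n) (S::nat \<Rightarrow> real^'n^'n).
      (\<forall>j<m. 0 \<le> w j) \<and> (\<Sum>j<m. w j) = 1 \<and> (\<forall>j<m. pos_def_mat (S j))
      \<and> g = (\<lambda>x. \<Sum>j<m. w j * gauss_density (mu j) (S j) x))"

definition kl_integrand :: "real \<Rightarrow> real \<Rightarrow> ereal" where
  "kl_integrand a b = (if a = 0 then 0 else if b = 0 then \<infinity> else ereal (a * ln (a / b)))"

definition KL :: "(real^'n \<Rightarrow> real) \<Rightarrow> (real^'n \<Rightarrow> real) \<Rightarrow> ereal" where
  "KL f g = enn2ereal (\<integral>\<^sup>+ x. e2ennreal (max 0 (kl_integrand (f x) (g x))) \<partial>lborel)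
          - enn2ereal (\<integral>\<^sup>+ x. e2ennreal (max 0 (- kl_integrand (f x) (g x))) \<partial>lborel)"

definition log_plus :: "real \<Rightarrow> real" where
  "log_plus t = (if t > 0 then max (ln t) 0 else 0)"

abbreviation dist_of :: "(real^'n \<Rightarrow> real) \<Rightarrow> (real^'n) measure" where
  "dist_of f \<equiv> density lborel (\<lambda>x. ennreal (f x))"

definition unif_integrable :: "'a measure \<Rightarrow> (nat \<Rightarrow> 'a \<Rightarrow> real) \<Rightarrow> bool" where
  "unif_integrable M X \<longleftrightarrow>
     ((\<lambda>c. SUP m. \<integral>\<^sup>+ x. ennreal (X m x) * indicator {y. X m y > c} x \<partial>M) \<longlongrightarrow> 0) at_top"

end

theory Submission
  imports Defs
begin

text \<open>
  If some mixture \<open>g\<close> has finite divergence, then \<open>f log\<^sub>+ (f / g)\<close> is integrable. As \<open>g\<close> has Gaussian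
  tails, \<open>g exp (\<epsilon> \<bar>x\<bar>\<^sup>2)\<close> is integrable for some \<open>\<epsilon> > 0\<close>, and Young's inequality
  \<open>\<epsilon> \<bar>x\<bar>\<^sup>2 f \<le> f log\<^sub>+ (f / g) + g exp (\<epsilon> \<bar>x\<bar>\<^sup>2)\<close> bounds the second moment. Conversely, the
  divergence from the approximating mixtures is at most the mean of \<open>L\<^sub>m\<close> under \<open>F\<close>, which tends to
  zero by Vitali's argument, while Gibbs' inequality makes every divergence nonnegative; the latter
  needs the exact total mass of a Gaussian, obtained by whitening the covariance matrix.
\<close>

section \<open>Linear change of variables\<close>

text \<open>Volumes of boxes and scaling factors come as products over \<open>Basis\<close>,
  determinants as products over the index type; this links the two.\<close>

lemma prod_Basis_vec:
  fixes F :: "real^'n \<Rightarrow> 'b::comm_monoid_mult"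
  shows "(\<Prod>b\<in>Basis. F b) = (\<Prod>i\<in>UNIV. F (axis i 1))"
proof -
  have B: "(Basis :: (real^'n) set) = range (\<lambda>i. axis i 1)"
    by (auto simp: Basis_vec_def)
  have "inj (\<lambda>i::'n. axis i (1::real))"
    by (auto simp: inj_on_def axis_eq_axis)
  then show ?thesis
    unfolding B by (subst prod.reindex) (simp_all add: o_def)
qed

lemma nn_integral_lborel_translation:
  fixes h :: "'a::euclidean_space \<Rightarrow> ennreal"
  assumes [measurable]: "h \<in> borel_measurable borel"
  shows "(\<integral>\<^sup>+x. h (x + t) \<partial>lborel) = (\<integral>\<^sup>+x. h x \<partial>lborel)"
proof -
  have "(\<integral>\<^sup>+x. h x \<partial>lborel) = (\<integral>\<^sup>+x. h x \<partial>distr lborel borel ((+) t))"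
    by (simp add: lborel_distr_plus)
  also have "\<dots> = (\<integral>\<^sup>+x. h (x + t) \<partial>lborel)"
    by (subst nn_integral_distr) (simp_all add: add.commute)
  finally show ?thesis ..
qed

text \<open>With the other coordinates frozen, the shear is a translation along \<open>b\<close> by
  a constant, because \<phi> does not change along \<open>b\<close>. Integrating over the
  \<open>b\<close> coordinate first therefore leaves the integral unchanged.\<close>

lemma nn_integral_lborel_shear:
  fixes h :: "'a::euclidean_space \<Rightarrow> ennreal"
  assumes h[measurable]: "h \<in> borel_measurable borel" and b: "b \<in> Basis"
    and \<phi>[measurable]: "\<phi> \<in> borel_measurable borel" and inv: "\<And>x t. \<phi> (x + t *\<^sub>R b) = \<phi> x"
  shows "(\<integral>\<^sup>+x. h (x + \<phi> x *\<^sub>R b) \<partial>lborel) = (\<integral>\<^sup>+x. h x \<partial>lborel)"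
proof -
  let ?M = "\<lambda>_::'a. lborel :: real measure"
  let ?s = "\<lambda>f. \<Sum>c\<in>Basis. f c *\<^sub>R (c::'a)"
  let ?s' = "\<lambda>f. \<Sum>c\<in>Basis-{b}. f c *\<^sub>R (c::'a)"
  interpret product_sigma_finite ?M by standard
  have lb: "(lborel :: 'a measure) = distr (\<Pi>\<^sub>M c\<in>Basis. lborel) borel ?s"
    unfolding lborel_eq_real by (rule lborel_def)
  have ins: "insert b (Basis - {b}) = (Basis :: 'a set)" using b by auto
  have s: "?s (x(b := y)) = ?s' x + y *\<^sub>R b" for x y
    using b by (subst ins[symmetric], subst sum.insert)
      (auto simp: add.commute intro!: sum.cong arg_cong2[where f="(+)"])
  \<comment> \<open>Tonelli on the product measure, with the \<open>b\<close> coordinate as the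
    inner integral.\<close>
  have eq: "(\<integral>\<^sup>+x. k x \<partial>lborel) = (\<integral>\<^sup>+x. (\<integral>\<^sup>+y. k (?s' x + y *\<^sub>R b) \<partial>lborel) \<partial>Pi\<^sub>M (Basis - {b}) ?M)"
    if [measurable]: "k \<in> borel_measurable borel" for k :: "'a \<Rightarrow> ennreal"
  proof -
    have "(\<integral>\<^sup>+x. k x \<partial>lborel) = (\<integral>\<^sup>+x. k (?s x) \<partial>Pi\<^sub>M (insert b (Basis - {b})) ?M)"
      unfolding ins by (subst lb) (simp add: nn_integral_distr)
    also have "\<dots> = (\<integral>\<^sup>+x. (\<integral>\<^sup>+y. k (?s (x(b := y))) \<partial>lborel) \<partial>Pi\<^sub>M (Basis - {b}) ?M)"
      by (rule product_nn_integral_insert) (simp_all only: ins, auto)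
    finally show ?thesis by (simp only: s)
  qed
  have "(\<integral>\<^sup>+x. h (x + \<phi> x *\<^sub>R b) \<partial>lborel)
      = (\<integral>\<^sup>+x. (\<integral>\<^sup>+y. h (?s' x + (y + \<phi> (?s' x)) *\<^sub>R b) \<partial>lborel) \<partial>Pi\<^sub>M (Basis - {b}) ?M)"
    by (subst eq) (simp_all add: inv scaleR_add_left add.assoc)
  also have "\<dots> = (\<integral>\<^sup>+x. (\<integral>\<^sup>+y. h (?s' x + y *\<^sub>R b) \<partial>lborel) \<partial>Pi\<^sub>M (Basis - {b}) ?M)"
    by (intro nn_integral_cong nn_integral_lborel_translation[where h="\<lambda>y. h (_ + y *\<^sub>R b)"]) simp
  also have "\<dots> = (\<integral>\<^sup>+x. h x \<partial>lborel)"
    by (rule eq[symmetric]) simp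
  finally show ?thesis .
qed

lemma nn_integral_lborel_stretch:
  fixes h :: "real^'n \<Rightarrow> ennreal"
  assumes [measurable]: "h \<in> borel_measurable borel" and c: "\<And>i. c i \<noteq> 0"
  shows "(\<integral>\<^sup>+x. h x \<partial>lborel) = ennreal \<bar>\<Prod>i\<in>UNIV. c i\<bar> * (\<integral>\<^sup>+x. h (\<chi> i. c i * x $ i) \<partial>lborel)"
proof -
  let ?c = "\<lambda>b::real^'n. vec_lambda c \<bullet> b"
  have nz: "?c j \<noteq> 0" if "j \<in> Basis" for j :: "real^'n"
    using that c by (auto simp: Basis_vec_def inner_axis)
  have T: "0 + (\<Sum>j\<in>Basis. (?c j * (x \<bullet> j)) *\<^sub>R j) = (\<chi> i. c i * x $ i)" for x :: "real^'n"
  proof (rule euclidean_eqI)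
    fix b :: "real^'n" assume "b \<in> Basis"
    then show "(0 + (\<Sum>j\<in>Basis. (?c j * (x \<bullet> j)) *\<^sub>R j)) \<bullet> b = (\<chi> i. c i * x $ i) \<bullet> b"
      by (auto simp: inner_sum_left_Basis) (auto simp: Basis_vec_def inner_axis)
  qed
  have "continuous_on UNIV (\<lambda>x::real^'n. \<chi> i. c i * x $ i)"
    by (intro continuous_intros)
  then have [measurable]: "(\<lambda>x::real^'n. \<chi> i. c i * x $ i) \<in> borel_measurable borel"
    by (rule borel_measurable_continuous_onI)
  have "lborel = density (distr lborel borel (\<lambda>x. \<chi> i. c i * x $ i)) (\<lambda>_. (\<Prod>j\<in>Basis. \<bar>?c j\<bar>))"
    using lborel_affine_euclidean[where c="?c" and t=0, OF nz] unfolding T .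
  then have "(\<integral>\<^sup>+x. h x \<partial>lborel)
      = (\<integral>\<^sup>+x. h x \<partial>density (distr lborel borel (\<lambda>x. \<chi> i. c i * x $ i)) (\<lambda>_. (\<Prod>j\<in>Basis. \<bar>?c j\<bar>)))"
    by (rule arg_cong)
  then show ?thesis
    by (simp add: nn_integral_density nn_integral_distr nn_integral_cmult prod_Basis_vec inner_axis
        abs_prod)
qed

text \<open>Boxes determine Lebesgue measure, and the preimage of a box under a swap of coordinates
  is a box with the same side lengths in another order.\<close>

lemma lborel_distr_transpose:
  "distr lborel borel (\<lambda>x::real^'n. \<chi> i. x $ Transposition.transpose m n i) = lborel"
proof -
  let ?h = "\<lambda>v::real^'n. \<chi> i. v $ Transposition.transpose m n i"
  have "continuous_on UNIV ?h"
    by (intro continuous_intros)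
  then have [measurable]: "?h \<in> borel_measurable borel"
    by (rule borel_measurable_continuous_onI)
  show ?thesis
  proof (rule lborel_eqI[symmetric])
    fix l u :: "real^'n" assume le: "\<And>b. b \<in> Basis \<Longrightarrow> l \<bullet> b \<le> u \<bullet> b"
    then have le': "l $ i \<le> u $ i" for i
      by (metis axis_in_Basis_iff cart_eq_inner_axis insertI1 Basis_real_def)
    have "?h -` box l u = box (?h l) (?h u)"
      by (auto simp: mem_box_cart) (metis transpose_involutory)+
    then have "emeasure (distr lborel borel ?h) (box l u) = emeasure lborel (box (?h l) (?h u))"
      by (simp add: emeasure_distr)
    also have "\<dots> = ennreal (\<Prod>i\<in>UNIV. (u - l) $ Transposition.transpose m n i)"
      using le' by (subst emeasure_lborel_box) (auto simp: Basis_vec_def inner_axis prod_Basis_vec[unfolded Basis_vec_def Basis_real_def, simplified])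
    also have "(\<Prod>i\<in>UNIV. (u - l) $ Transposition.transpose m n i) = (\<Prod>i\<in>UNIV. (u - l) $ i)"
      using prod.permute[OF permutes_swap_id, where S=UNIV and g="\<lambda>i. (u - l)$i"]
      by (simp add: o_def)
    finally show "emeasure (distr lborel borel ?h) (box l u) = (\<Prod>b\<in>Basis. (u - l) \<bullet> b)"
      by (simp add: prod_Basis_vec inner_axis)
  qed simp
qed

text \<open>The matrix is a column permutation of the identity, up to transposition; the absolute
  value removes the sign of the permutation.\<close>

lemma det_matrix_transpose:
  assumes "m \<noteq> n"
  shows "\<bar>det (matrix (\<lambda>x::real^'n. \<chi> i. x $ Transposition.transpose m n i))\<bar> = 1"
proof -
  let ?h = "\<lambda>x::real^'n. \<chi> i. x $ Transposition.transpose m n i"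
  have "(\<chi> i j. if Transposition.transpose m n i = j then 1 else 0)
      = (\<chi> i j. if j = Transposition.transpose m n i then 1 else (0::real))"
    by (auto intro!: Cart_lambda_cong)
  then have "matrix ?h = transpose (\<chi> i j. mat 1 $ i $ Transposition.transpose m n j)"
    by (auto simp: matrix_eq transpose_def axis_def mat_def matrix_def)
  then show ?thesis
    by (simp add: det_permute_columns permutes_swap_id sign_swap_id abs_mult)
qed

text \<open>The matrix arises from the identity by adding row \<open>n\<close> to row
  \<open>m\<close>, a determinant-preserving operation.\<close>

lemma det_matrix_shear:
  assumes "m \<noteq> n"
  shows "det (matrix (\<lambda>x::real^'n. \<chi> i. if i = m then x $ m + x $ n else x $ i)) = 1"
proof -
  have "matrix (\<lambda>x::real^'n. \<chi> i. if i = m then x $ m + x $ n else x $ i)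
      = (\<chi> k. if k = m then row m (mat 1) + 1 *s row n (mat 1) else row k (mat 1))"
    by (auto simp: matrix_def axis_def mat_def row_def vec_eq_iff)
  then show ?thesis
    by (simp only: det_row_operation[OF assms] det_I)
qed

text \<open>The change of variables theorems of HOL-Analysis require a well-ordered index type, so the
  linear case is proved for an arbitrary finite one.\<close>

lemma nn_integral_lborel_linear:
  fixes h :: "real^'n \<Rightarrow> ennreal"
  assumes "linear f" and "det (matrix f) \<noteq> 0" and "h \<in> borel_measurable borel"
  shows "(\<integral>\<^sup>+x. h x \<partial>lborel) = ennreal \<bar>det (matrix f)\<bar> * (\<integral>\<^sup>+x. h (f x) \<partial>lborel)"
proof -
  \<comment> \<open>The determinant condition sits inside the induction predicate so that singular
    maps satisfy it vacuously. Quantifying over \<open>h\<close> lets the composition case use the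
    hypothesis on \<open>g\<close> for the function \<open>h\<close> composed with
    \<open>f\<close>.\<close>
  let ?P = "\<lambda>f::real^'n \<Rightarrow> real^'n. det (matrix f) \<noteq> 0 \<longrightarrow> (\<forall>h\<in>borel_measurable borel.
     (\<integral>\<^sup>+x. h x \<partial>lborel) = ennreal \<bar>det (matrix f)\<bar> * (\<integral>\<^sup>+x. h (f x) \<partial>lborel))"
  have "?P f"
  proof (rule induct_linear_elementary[OF \<open>linear f\<close>])
    fix f g :: "real^'n \<Rightarrow> real^'n"
    assume lin: "linear f" "linear g" and P: "?P f" "?P g"
    have det: "det (matrix (f \<circ> g)) = det (matrix f) * det (matrix g)"
      by (simp add: matrix_compose lin det_mul)
    have [measurable]: "f \<in> borel_measurable borel"
      using lin(1) by (intro borel_measurable_continuous_onI linear_continuous_on)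
        (simp add: linear_linear)
    show "?P (f \<circ> g)"
    proof (intro impI ballI)
      fix h :: "real^'n \<Rightarrow> ennreal"
      assume nz: "det (matrix (f \<circ> g)) \<noteq> 0" and h[measurable]: "h \<in> borel_measurable borel"
      have "(\<lambda>x. h (f x)) \<in> borel_measurable borel" by simp
      with P nz h show "(\<integral>\<^sup>+x. h x \<partial>lborel)
          = ennreal \<bar>det (matrix (f \<circ> g))\<bar> * (\<integral>\<^sup>+x. h ((f \<circ> g) x) \<partial>lborel)"
        by (simp add: det abs_mult ennreal_mult mult.assoc)
    qed
  next
    fix f :: "real^'n \<Rightarrow> real^'n" and i
    assume "linear f" and "\<And>x. f x $ i = 0"
    \<comment> \<open>A map with a vanishing coordinate misses the all-ones vector, so its
      determinant is zero.\<close>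
    then have "\<not> surj f"
      by (metis one_neq_zero surjE vec_component)
    then show "?P f"
      using \<open>linear f\<close> det_nz_iff_inj linear_injective_imp_surjective by blast
  next
    fix c :: "'n \<Rightarrow> real"
    have det: "det (matrix (\<lambda>x::real^'n. \<chi> i. c i * x $ i)) = (\<Prod>i\<in>UNIV. c i)"
      by (simp add: axis_def matrix_def det_diagonal)
    show "?P (\<lambda>x. \<chi> i. c i * x $ i)"
      unfolding det using nn_integral_lborel_stretch[of _ c] by auto
  next
    fix m n :: 'n assume mn: "m \<noteq> n"
    let ?h = "\<lambda>v::real^'n. \<chi> i. v $ Transposition.transpose m n i"
    have "continuous_on UNIV ?h"
      by (intro continuous_intros)
    then have [measurable]: "?h \<in> borel_measurable borel"
      by (rule borel_measurable_continuous_onI)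
    have eq: "(\<integral>\<^sup>+x. h x \<partial>lborel) = (\<integral>\<^sup>+x. h (?h x) \<partial>lborel)" if [measurable]: "h \<in> borel_measurable borel"
      for h :: "real^'n \<Rightarrow> ennreal"
      by (subst lborel_distr_transpose[of m n, symmetric]) (simp add: nn_integral_distr)
    then show "?P ?h"
      unfolding det_matrix_transpose[OF mn] ennreal_1 mult_1 by blast
  next
    fix m n :: 'n assume mn: "m \<noteq> n"
    have eq: "(\<chi> i. if i = m then x $ m + x $ n else x $ i) = x + (x $ n) *\<^sub>R axis m 1" for x :: "real^'n"
      by (simp add: vec_eq_iff axis_def)
    have m: "axis m 1 \<in> (Basis :: (real^'n) set)"
      by (simp add: axis_in_Basis_iff)
    have inv: "(x + t *\<^sub>R axis m 1) $ n = x $ n" for x :: "real^'n" and t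
      using mn by (simp add: axis_def)
    have [measurable]: "(\<lambda>x::real^'n. x $ n) \<in> borel_measurable borel"
      by (intro borel_measurable_continuous_onI continuous_intros)
    note shear = nn_integral_lborel_shear[OF _ m, of _ "\<lambda>x. x $ n", OF _ _ inv]
    show "?P (\<lambda>x. \<chi> i. if i = m then x $ m + x $ n else x $ i)"
      unfolding det_matrix_shear[OF mn] unfolding eq by (simp add: shear)
  qed
  with assms show ?thesis by blast
qed

section \<open>Gaussian densities\<close>

text \<open>For \<open>M = L\<close> the entries are the \<open>S\<close>-inner products of the rows
  of \<open>L\<close>, so whitening \<open>S\<close> amounts to finding \<open>S\<close>-orthonormal
  rows.\<close>

lemma matrix_sandwich_nth:
  fixes L S M :: "real^'n^'n"
  shows "(L ** S ** transpose M) $ i $ j = row i L \<bullet> (S *v row j M)"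
  by (simp add: matrix_matrix_mult_def matrix_vector_mult_def transpose_def row_def inner_vec_def
      sum_distrib_left sum_distrib_right mult.assoc) (rule sum.swap)

text \<open>Gram-Schmidt for the inner product defined by \<open>S\<close>, adding one vector at a
  time.\<close>

lemma pos_def_mat_orthonormal_family:
  fixes S :: "real^'n^'n"
  assumes S: "pos_def_mat S" and "k \<le> CARD('n)"
  shows "\<exists>f::nat \<Rightarrow> real^'n. \<forall>i<k. \<forall>j<k. f i \<bullet> (S *v f j) = of_bool (i = j)"
  using \<open>k \<le> CARD('n)\<close>
proof (induction k)
  case (Suc k)
  then obtain f :: "nat \<Rightarrow> real^'n"
    where f': "\<forall>i<k. \<forall>j<k. f i \<bullet> (S *v f j) = of_bool (i = j)"
    using Suc_leD by blast
  then have f: "f i \<bullet> (S *v f j) = of_bool (i = j)" if "i < k" "j < k" for i j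
    using that by blast
  have sym: "x \<bullet> (S *v y) = y \<bullet> (S *v x)" for x y
    using S by (metis dot_lmul_matrix inner_commute pos_def_mat_def transpose_matrix_vector)
  let ?V = "(\<lambda>i. S *v f i) ` {..<k}"
  \<comment> \<open>The \<open>k\<close> vectors \<open>S *v f i\<close> span a proper subspace, so
    a nonzero \<open>a\<close> is Euclidean-orthogonal to all of them, which is
    \<open>S\<close>-orthogonality to every \<open>f i\<close>.\<close>
  have "dim ?V \<le> card {..<k}"
    by (meson card_image_le dim_le_card' finite_imageI finite_lessThan order_trans)
  then have "dim ?V < DIM(real^'n)"
    using Suc.prems by simp
  then obtain a where a: "a \<noteq> 0" "span ?V \<subseteq> {x. a \<bullet> x = 0}"
    using lowdim_subset_hyperplane by blast
  have orth: "a \<bullet> (S *v f i) = 0" if "i < k" for i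
    using a(2) that by (force intro: span_base)
  define s where "s = a \<bullet> (S *v a)"
  have s: "s > 0"
    using S a(1) by (simp add: pos_def_mat_def s_def)
  define g where "g = f(k := (1 / sqrt s) *\<^sub>R a)"
  have "g k \<bullet> (S *v g k) = 1"
    using s by (simp add: g_def matrix_vector_mult_scaleR flip: s_def)
  moreover have "g k \<bullet> (S *v g i) = 0" "g i \<bullet> (S *v g k) = 0" if "i < k" for i
    using orth[OF that] that sym[of "g i" "g k"] by (simp_all add: g_def)
  moreover have "g i \<bullet> (S *v g j) = of_bool (i = j)" if "i < k" "j < k" for i j
    using f[OF that] that by (simp add: g_def)
  ultimately show ?case
    by (intro exI[of _ g]) (auto simp: less_Suc_eq)
qed simp

lemma pos_def_mat_whitening:
  fixes S :: "real^'n^'n"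
  assumes "pos_def_mat S"
  obtains L :: "real^'n^'n" where "L ** S ** transpose L = mat 1"
proof -
  obtain f :: "nat \<Rightarrow> real^'n"
    where f: "f i \<bullet> (S *v f j) = of_bool (i = j)" if "i < CARD('n)" "j < CARD('n)" for i j
    using pos_def_mat_orthonormal_family[OF assms, of "CARD('n)"] by auto
  obtain h :: "'n \<Rightarrow> nat" where h: "bij_betw h UNIV {0..<CARD('n)}"
    using ex_bij_betw_finite_nat[OF finite_class.finite_UNIV] by blast
  have "h i < CARD('n)" for i
    using bij_betwE[OF h] by simp
  moreover have "h i = h j \<longleftrightarrow> i = j" for i j
    using bij_betw_imp_inj_on[OF h] by (simp add: inj_eq)
  moreover have "row i (\<chi> i. f (h i)) = f (h i)" for i
    by (simp add: row_def vec_eq_iff)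
  ultimately have "((\<chi> i. f (h i)) ** S ** transpose (\<chi> i. f (h i))) $ i $ j = mat 1 $ i $ j" for i j
    unfolding matrix_sandwich_nth by (simp add: f mat_def)
  then have "(\<chi> i. f (h i)) ** S ** transpose (\<chi> i. f (h i)) = mat 1"
    by (simp only: vec_eq_iff) simp
  then show thesis ..
qed

text \<open>\<open>matrix_inv\<close> is a choice among two-sided inverses. For square matrices a
  right inverse is two-sided, and uniqueness then fixes the choice.\<close>

lemma matrix_inv_eqI:
  fixes A B :: "real^'n^'n"
  assumes "A ** B = mat 1"
  shows "matrix_inv A = B"
proof -
  have BA: "B ** A = mat 1"
    using assms by (rule matrix_left_right_inverse1)
  then have "A ** matrix_inv A = mat 1"
    unfolding matrix_inv_def using assms by (metis (mono_tags, lifting) someI_ex)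
  then show ?thesis
    by (metis BA matrix_mul_assoc matrix_mul_lid matrix_mul_rid)
qed

text \<open>From \<open>L ** S ** transpose L = mat 1\<close> follow
  \<open>matrix_inv S = transpose L ** L\<close> and \<open>det S = 1 / (det L)\<^sup>2\<close>. The
  density is thus a standard Gaussian after an affine map, with the Jacobian factor of that map
  split off.\<close>

lemma gauss_density_whitened:
  fixes S :: "real^'n^'n"
  assumes "pos_def_mat S"
  obtains L :: "real^'n^'n" where "det L \<noteq> 0"
    and "\<And>mu x. gauss_density mu S x =
           \<bar>det L\<bar> * (exp (- (norm (L *v (x - mu)))\<^sup>2 / 2) / sqrt (2 * pi) ^ CARD('n))"
proof -
  obtain L :: "real^'n^'n" where L: "L ** S ** transpose L = mat 1"
    using pos_def_mat_whitening[OF assms] .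
  then have "transpose L ** L ** S = mat 1"
    by (metis matrix_left_right_inverse1 matrix_mul_assoc)
  then have inv: "matrix_inv S = transpose L ** L"
    by (metis matrix_inv_eqI matrix_left_right_inverse1)
  have quad: "y \<bullet> (matrix_inv S *v y) = (norm (L *v y))\<^sup>2" for y
    unfolding inv power2_norm_eq_inner matrix_vector_mul_assoc[symmetric]
    by (simp add: inner_commute[of y] dot_lmul_matrix)
  have det: "det L * det S * det L = 1"
    using arg_cong[OF L, of det] by (simp add: det_mul)
  then have L0: "det L \<noteq> 0"
    by auto
  with det have "det S = 1 / (det L)\<^sup>2"
    by (simp add: power2_eq_square eq_divide_eq mult_ac)
  then have "sqrt ((2 * pi) ^ CARD('n) * det S) = sqrt (2 * pi) ^ CARD('n) / \<bar>det L\<bar>"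
    by (simp only: times_divide_eq_right mult_1_right real_sqrt_divide real_sqrt_power[of "2 * pi"] real_sqrt_abs)
  then have "gauss_density mu S x =
          \<bar>det L\<bar> * (exp (- (norm (L *v (x - mu)))\<^sup>2 / 2) / sqrt (2 * pi) ^ CARD('n))" for mu x
    by (simp add: gauss_density_def quad)
  with L0 show thesis by (rule that)
qed

section \<open>Total mass and exponential moments of a Gaussian\<close>

text \<open>The integrand is a product of one-dimensional normal densities. Width 1 serves the total
  mass, a larger freedom in \<sigma> the tail bound.\<close>

lemma nn_integral_exp_norm:
  fixes \<sigma> :: real
  assumes "\<sigma> > 0"
  shows "(\<integral>\<^sup>+x. ennreal (exp (- (norm (x::'a::euclidean_space))\<^sup>2 / (2 * \<sigma>\<^sup>2)) / sqrt (2 * pi * \<sigma>\<^sup>2) ^ DIM('a)) \<partial>lborel) = 1"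
proof -
  have eq: "(\<Prod>b\<in>Basis. normal_density 0 \<sigma> (x \<bullet> b))
      = exp (- (norm x)\<^sup>2 / (2 * \<sigma>\<^sup>2)) / sqrt (2 * pi * \<sigma>\<^sup>2) ^ DIM('a)" for x :: 'a
  proof -
    have "- (norm x)\<^sup>2 / (2 * \<sigma>\<^sup>2) = (\<Sum>b\<in>Basis. - (x \<bullet> b)\<^sup>2 / (2 * \<sigma>\<^sup>2))"
      unfolding power2_norm_eq_inner euclidean_inner[of x x]
      by (simp add: sum_negf sum_divide_distrib power2_eq_square)
    then show ?thesis
      by (simp only: exp_sum finite_Basis) (simp add: normal_density_def prod_dividef)
  qed
  have "(\<integral>\<^sup>+x. ennreal (\<Prod>b\<in>Basis. normal_density 0 \<sigma> ((x::'a) \<bullet> b)) \<partial>lborel)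
      = (\<integral>\<^sup>+x. (\<Prod>b\<in>Basis. ennreal (normal_density 0 \<sigma> ((x::'a) \<bullet> b))) \<partial>lborel)"
    by (simp add: prod_ennreal)
  also have "\<dots> = (\<Prod>b\<in>(Basis::'a set). \<integral>\<^sup>+x. ennreal (normal_density 0 \<sigma> x) \<partial>lborel)"
    by (rule nn_integral_lborel_prod) auto
  also have "\<dots> = 1"
    using assms by (simp add: nn_integral_eq_integral)
  finally show ?thesis by (simp only: eq)
qed

lemma borel_measurable_gauss_density [measurable]:
  "gauss_density mu S \<in> borel_measurable borel"
proof -
  have [measurable]: "(\<lambda>x. (x - mu) \<bullet> (matrix_inv S *v (x - mu))) \<in> borel_measurable borel"
    by (intro borel_measurable_continuous_onI continuous_intros
        bounded_linear.continuous_on[OF matrix_vector_mul_bounded_linear])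
  show ?thesis
    unfolding gauss_density_def by measurable
qed

lemma gauss_density_pos:
  fixes S :: "real^'n^'n"
  assumes "pos_def_mat S"
  shows "0 < gauss_density mu S x"
proof -
  obtain L :: "real^'n^'n" where "det L \<noteq> 0"
    and "\<And>mu x. gauss_density mu S x =
           \<bar>det L\<bar> * (exp (- (norm (L *v (x - mu)))\<^sup>2 / 2) / sqrt (2 * pi) ^ CARD('n))"
    using gauss_density_whitened[OF assms] by blast
  then show ?thesis by simp
qed

text \<open>After translation by \<open>mu\<close>, the substitution \<open>y = L *v x\<close>
  absorbs the factor \<open>\<bar>det L\<bar>\<close> exactly.\<close>

lemma nn_integral_gauss_density:
  fixes S :: "real^'n^'n"
  assumes "pos_def_mat S"
  shows "(\<integral>\<^sup>+x. ennreal (gauss_density mu S x) \<partial>lborel) = 1"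
proof -
  obtain L :: "real^'n^'n" where L: "det L \<noteq> 0"
    and eq: "\<And>mu x. gauss_density mu S x =
           \<bar>det L\<bar> * (exp (- (norm (L *v (x - mu)))\<^sup>2 / 2) / sqrt (2 * pi) ^ CARD('n))"
    using gauss_density_whitened[OF assms] by blast
  let ?h = "\<lambda>y::real^'n. ennreal (exp (- (norm y)\<^sup>2 / 2) / sqrt (2 * pi) ^ CARD('n))"
  have [measurable]: "(\<lambda>x. L *v x) \<in> borel_measurable borel"
    by (intro borel_measurable_continuous_onI matrix_vector_mult_linear_continuous_on)
  have "(\<integral>\<^sup>+x. ennreal (gauss_density mu S x) \<partial>lborel)
      = (\<integral>\<^sup>+x. ennreal \<bar>det L\<bar> * ?h (L *v (x + - mu)) \<partial>lborel)"
    by (simp add: eq ennreal_mult del: times_divide_eq_right)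
  also have "\<dots> = (\<integral>\<^sup>+x. ennreal \<bar>det L\<bar> * ?h (L *v x) \<partial>lborel)"
    by (rule nn_integral_lborel_translation[where h="\<lambda>x. ennreal \<bar>det L\<bar> * ?h (L *v x)"]) simp
  also have "\<dots> = ennreal \<bar>det L\<bar> * (\<integral>\<^sup>+x. ?h (L *v x) \<partial>lborel)"
    by (rule nn_integral_cmult) simp
  also have "\<dots> = (\<integral>\<^sup>+x. ?h x \<partial>lborel)"
    using nn_integral_lborel_linear[of "(*v) L" ?h] L by (simp add: matrix_vector_mul_linear)
  also have "\<dots> = 1"
    using nn_integral_exp_norm[of 1, where 'a="real^'n"] by simp
  finally show ?thesis .
qed

text \<open>An invertible \<open>L\<close> satisfies \<open>B * norm x \<le> norm (L *v x)\<close>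
  for some \<open>B > 0\<close>, so the Gaussian decay outweighs a small quadratic exponent. The
  bound covers all \<epsilon> up to a threshold so that finitely many components can share one
  exponent.\<close>

lemma gauss_density_exp_moment:
  fixes S :: "real^'n^'n"
  assumes "pos_def_mat S"
  obtains \<delta> where "\<delta> > 0"
    and "\<And>\<epsilon>. \<epsilon> \<le> \<delta> \<Longrightarrow> (\<integral>\<^sup>+x. ennreal (gauss_density mu S x * exp (\<epsilon> * (norm x)\<^sup>2)) \<partial>lborel) < \<infinity>"
proof -
  obtain L :: "real^'n^'n" where L: "det L \<noteq> 0"
    and eq: "\<And>mu x. gauss_density mu S x =
           \<bar>det L\<bar> * (exp (- (norm (L *v (x - mu)))\<^sup>2 / 2) / sqrt (2 * pi) ^ CARD('n))"
    using gauss_density_whitened[OF assms] by blast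
  have "inj ((*v) L)"
    using L det_nz_iff_inj[OF matrix_vector_mul_linear, of L] by simp
  then obtain B where B: "B > 0" "\<And>x. B * norm x \<le> norm (L *v x)"
    using linear_inj_bounded_below_pos[OF matrix_vector_mul_linear] by metis
  \<comment> \<open>The decay available is \<open>B\<^sup>2 / 2\<close> times
    \<open>(norm (x - mu))\<^sup>2\<close>. Splitting \<open>norm x\<close> around \<open>mu\<close>
    costs at most \<open>2 * \<delta> = B\<^sup>2 / 4\<close> of it; the other half is the exponent
    of a Gaussian of width \<sigma>, and \<open>C\<close> collects the constants.\<close>
  define \<delta> where "\<delta> = B\<^sup>2 / 8"
  define \<sigma> where "\<sigma> = sqrt 2 / B"
  define C where "C = \<bar>det L\<bar> / sqrt (2 * pi) ^ CARD('n) * exp (2 * \<delta> * (norm mu)\<^sup>2)"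
  define K where "K = sqrt (2 * pi * \<sigma>\<^sup>2) ^ DIM(real^'n)"
  have \<sigma>: "\<sigma> > 0" "1 / (2 * \<sigma>\<^sup>2) = 2 * \<delta>"
    using B(1) by (simp_all add: \<sigma>_def \<delta>_def field_simps)
  have K: "K > 0" and C: "C \<ge> 0"
    using \<sigma>(1) by (simp_all add: K_def C_def)
  have \<delta>: "\<delta> > 0"
    using B(1) by (simp add: \<delta>_def)
  have bound: "gauss_density mu S x * exp (\<epsilon> * (norm x)\<^sup>2)
      \<le> C * K * (exp (- (norm (x - mu))\<^sup>2 / (2 * \<sigma>\<^sup>2)) / K)" if "\<epsilon> \<le> \<delta>" for \<epsilon> x
  proof -
    have "(norm x)\<^sup>2 \<le> (norm (x - mu) + norm mu)\<^sup>2"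
      by (intro power_mono) (use norm_triangle_ineq[of "x - mu" mu] in auto)
    also have "\<dots> \<le> 2 * (norm (x - mu))\<^sup>2 + 2 * (norm mu)\<^sup>2"
      using sum_squares_bound[of "norm (x - mu)" "norm mu"] by (simp add: power2_sum)
    finally have "\<epsilon> * (norm x)\<^sup>2 \<le> \<delta> * (2 * (norm (x - mu))\<^sup>2 + 2 * (norm mu)\<^sup>2)"
      using that \<delta> by (intro mult_mono) auto
    moreover have "(B * norm (x - mu))\<^sup>2 \<le> (norm (L *v (x - mu)))\<^sup>2"
      using B by (intro power_mono) auto
    ultimately have "- (norm (L *v (x - mu)))\<^sup>2 / 2 + \<epsilon> * (norm x)\<^sup>2
        \<le> 2 * \<delta> * (norm mu)\<^sup>2 + - (norm (x - mu))\<^sup>2 * (1 / (2 * \<sigma>\<^sup>2))"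
      unfolding \<sigma>(2) by (simp add: power_mult_distrib \<delta>_def field_simps)
    then have "exp (- (norm (L *v (x - mu)))\<^sup>2 / 2) * exp (\<epsilon> * (norm x)\<^sup>2)
        \<le> exp (2 * \<delta> * (norm mu)\<^sup>2) * exp (- (norm (x - mu))\<^sup>2 / (2 * \<sigma>\<^sup>2))"
      by (simp flip: exp_add)
    then have "\<bar>det L\<bar> / sqrt (2 * pi) ^ CARD('n) * (exp (- (norm (L *v (x - mu)))\<^sup>2 / 2) * exp (\<epsilon> * (norm x)\<^sup>2))
        \<le> \<bar>det L\<bar> / sqrt (2 * pi) ^ CARD('n) * (exp (2 * \<delta> * (norm mu)\<^sup>2) * exp (- (norm (x - mu))\<^sup>2 / (2 * \<sigma>\<^sup>2)))"
      by (intro mult_left_mono) auto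
    then show ?thesis
      using K by (simp add: eq C_def)
  qed
  have "(\<integral>\<^sup>+x. ennreal (gauss_density mu S x * exp (\<epsilon> * (norm x)\<^sup>2)) \<partial>lborel) < \<infinity>" if "\<epsilon> \<le> \<delta>" for \<epsilon>
  proof -
    let ?h = "\<lambda>x::real^'n. ennreal (exp (- (norm x)\<^sup>2 / (2 * \<sigma>\<^sup>2)) / K)"
    have "(\<integral>\<^sup>+x. ennreal (gauss_density mu S x * exp (\<epsilon> * (norm x)\<^sup>2)) \<partial>lborel)
        \<le> (\<integral>\<^sup>+x. ennreal (C * K) * ?h (x + - mu) \<partial>lborel)"
      using bound[OF that] C K
      by (intro nn_integral_mono) (simp add: ennreal_mult[symmetric] ennreal_leI del: times_divide_eq_right)
    also have "\<dots> = ennreal (C * K) * (\<integral>\<^sup>+x. ?h (x + - mu) \<partial>lborel)"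
      by (rule nn_integral_cmult) simp
    also have "(\<integral>\<^sup>+x. ?h (x + - mu) \<partial>lborel) = (\<integral>\<^sup>+x. ?h x \<partial>lborel)"
      by (rule nn_integral_lborel_translation) simp
    also have "\<dots> = 1"
      unfolding K_def by (rule nn_integral_exp_norm[OF \<sigma>(1)])
    finally show ?thesis
      by (rule le_less_trans) simp
  qed
  with \<delta> show thesis by (rule that)
qed

section \<open>Gaussian mixtures\<close>

lemma is_gmmE:
  assumes "is_gmm (g :: real^'n \<Rightarrow> real)"
  obtains m w mu S where "m > 0" "\<And>j. j < m \<Longrightarrow> 0 \<le> w j" "(\<Sum>j<m. w j) = 1"
    "\<And>j. j < m \<Longrightarrow> pos_def_mat (S j)"
    "g = (\<lambda>x::real^'n. \<Sum>j<(m::nat). w j * gauss_density (mu j) (S j) x)"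
proof -
  obtain m w mu S where "\<forall>j<m. 0 \<le> w j" "(\<Sum>j<m. w j) = 1"
    "\<forall>j<m. pos_def_mat (S j)"
    "g = (\<lambda>x::real^'n. \<Sum>j<(m::nat). w j * gauss_density (mu j) (S j) x)"
    using assms unfolding is_gmm_def by blast
  moreover from this have "m > 0"
    by (cases m) auto
  ultimately show thesis
    using that by blast
qed

lemma is_gmm_measurable [measurable_dest]:
  assumes "is_gmm g"
  shows "g \<in> borel_measurable borel"
  using assms by (elim is_gmmE) simp

text \<open>Weights summing to 1 include a positive one. Positivity keeps \<open>f x / g x\<close>
  meaningful and excludes the infinite branch of \<open>kl_integrand\<close>.\<close>

lemma is_gmm_pos:
  assumes "is_gmm g"
  shows "0 < g x"
  using assms
proof (cases rule: is_gmmE)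
  case (1 m w mu S)
  then obtain j where j: "j < m" "w j > 0"
    by (metis less_eq_real_def lessThan_iff sum.neutral zero_neq_one)
  have "0 < w j * gauss_density (mu j) (S j) x"
    using 1 j by (simp add: gauss_density_pos)
  then show ?thesis
    unfolding 1(5) using 1 j
    by (intro sum_pos2[of _ j]) (auto intro!: mult_nonneg_nonneg less_imp_le[OF gauss_density_pos])
qed

lemma nn_integral_is_gmm:
  assumes "is_gmm g"
  shows "(\<integral>\<^sup>+x. ennreal (g x) \<partial>lborel) = 1"
  using assms
proof (cases rule: is_gmmE)
  case (1 m w mu S)
  have "(\<integral>\<^sup>+x. ennreal (g x) \<partial>lborel)
      = (\<integral>\<^sup>+x. (\<Sum>j<m. ennreal (w j) * ennreal (gauss_density (mu j) (S j) x)) \<partial>lborel)"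
    unfolding 1(5) using 1(2,4)
    by (subst sum_ennreal[symmetric])
      (auto simp: ennreal_mult' intro!: nn_integral_cong sum.cong mult_nonneg_nonneg less_imp_le[OF gauss_density_pos])
  also have "\<dots> = (\<Sum>j<m. ennreal (w j) * (\<integral>\<^sup>+x. ennreal (gauss_density (mu j) (S j) x) \<partial>lborel))"
    by (simp add: nn_integral_sum nn_integral_cmult)
  also have "\<dots> = (\<Sum>j<m. ennreal (w j))"
    using 1 by (intro sum.cong) (simp_all add: nn_integral_gauss_density)
  also have "\<dots> = 1"
    using 1(2,3) by (subst sum_ennreal) auto
  finally show ?thesis .
qed

lemma is_gmm_exp_moment:
  assumes "is_gmm g"
  obtains \<epsilon> where "\<epsilon> > 0" and "(\<integral>\<^sup>+x. ennreal (g x * exp (\<epsilon> * (norm x)\<^sup>2)) \<partial>lborel) < \<infinity>"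
  using assms
proof (cases rule: is_gmmE)
  case (1 m w mu S)
  have "\<exists>\<delta>>0. \<forall>\<epsilon>\<le>\<delta>. (\<integral>\<^sup>+x. ennreal (gauss_density (mu j) (S j) x * exp (\<epsilon> * (norm x)\<^sup>2)) \<partial>lborel) < \<infinity>"
    if "j < m" for j
    using gauss_density_exp_moment[OF 1(4)[OF that]] by metis
  then obtain \<delta> where \<delta>: "\<delta> j > 0"
    "\<epsilon> \<le> \<delta> j \<Longrightarrow> (\<integral>\<^sup>+x. ennreal (gauss_density (mu j) (S j) x * exp (\<epsilon> * (norm x)\<^sup>2)) \<partial>lborel) < \<infinity>"
    if "j < m" for j \<epsilon>
    by metis
  \<comment> \<open>The smallest of the component thresholds works for all components; it is
    positive because there are finitely many and at least one.\<close>
  define \<epsilon> where "\<epsilon> = Min (\<delta> ` {..<m})"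
  have le: "\<epsilon> \<le> \<delta> j" if "j < m" for j
    using that by (simp add: \<epsilon>_def)
  have "\<epsilon> > 0"
    unfolding \<epsilon>_def using \<delta>(1) \<open>m > 0\<close> by (subst Min_gr_iff) (auto simp: lessThan_empty_iff)
  moreover have "(\<integral>\<^sup>+x. ennreal (g x * exp (\<epsilon> * (norm x)\<^sup>2)) \<partial>lborel) < \<infinity>"
  proof -
    have "(\<integral>\<^sup>+x. ennreal (g x * exp (\<epsilon> * (norm x)\<^sup>2)) \<partial>lborel)
      = (\<integral>\<^sup>+x. (\<Sum>j<m. ennreal (w j) * ennreal (gauss_density (mu j) (S j) x * exp (\<epsilon> * (norm x)\<^sup>2))) \<partial>lborel)"
      unfolding 1(5) sum_distrib_right mult.assoc using 1(2,4)
      by (subst sum_ennreal[symmetric])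
        (auto simp: ennreal_mult' intro!: nn_integral_cong sum.cong mult_nonneg_nonneg less_imp_le[OF gauss_density_pos])
    also have "\<dots> = (\<Sum>j<m. ennreal (w j) * (\<integral>\<^sup>+x. ennreal (gauss_density (mu j) (S j) x * exp (\<epsilon> * (norm x)\<^sup>2)) \<partial>lborel))"
      by (simp add: nn_integral_sum nn_integral_cmult)
    also have "\<dots> < \<infinity>"
      using \<delta>(2)[OF _ le] by (auto simp: ennreal_mult_less_top)
    finally show ?thesis .
  qed
  ultimately show thesis by (rule that)
qed

section \<open>Divergence from a Gaussian mixture\<close>

lemma log_plus_nonneg: "0 \<le> log_plus t"
  by (simp add: log_plus_def)

lemma borel_measurable_log_plus [measurable]: "log_plus \<in> borel_measurable borel"
  unfolding log_plus_def by measurable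

lemma max_zero_ereal: "max 0 (ereal x) = ereal (max 0 x)"
  by (simp add: max_def)

lemma kl_integrand_pos_part:
  assumes "0 \<le> a" "0 < b"
  shows "e2ennreal (max 0 (kl_integrand a b)) = ennreal (a * log_plus (a / b))"
proof -
  have "max 0 (kl_integrand a b) = ereal (a * log_plus (a / b))"
  proof (cases "a = 0")
    case False
    then have "0 < a / b" "0 < a" using assms by simp_all
    then show ?thesis
      using assms by (simp add: kl_integrand_def log_plus_def max_zero_ereal max_mult_distrib_left
          max.commute)
  qed (simp add: kl_integrand_def zero_ereal_def)
  then show ?thesis by (simp add: ennreal.rep_eq e2ennreal_ereal)
qed

text \<open>Negating the logarithm inverts the ratio; at \<open>a = 0\<close> the factor
  \<open>a\<close> makes both sides vanish.\<close>

lemma kl_integrand_neg_part: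
  assumes "0 \<le> a" "0 < b"
  shows "e2ennreal (max 0 (- kl_integrand a b)) = ennreal (a * log_plus (b / a))"
proof -
  have "max 0 (- kl_integrand a b) = ereal (a * log_plus (b / a))"
  proof (cases "a = 0")
    case False
    then have "0 < b / a" "0 < a" "a * ln (b / a) = - (a * ln (a / b))"
      using assms by (simp_all add: ln_div algebra_simps)
    then show ?thesis
      using assms by (simp add: kl_integrand_def log_plus_def max_zero_ereal max_mult_distrib_left
          max.commute)
  qed (simp add: kl_integrand_def zero_ereal_def)
  then show ?thesis by (simp add: ennreal.rep_eq e2ennreal_ereal)
qed

lemma KL_gmm_eq:
  assumes "prob_density f" "is_gmm g"
  shows "KL f g = enn2ereal (\<integral>\<^sup>+x. ennreal (f x * log_plus (f x / g x)) \<partial>lborel)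
                - enn2ereal (\<integral>\<^sup>+x. ennreal (f x * log_plus (g x / f x)) \<partial>lborel)"
  using assms is_gmm_pos[OF assms(2)]
  by (simp add: KL_def prob_density_def kl_integrand_pos_part kl_integrand_neg_part)

section \<open>Gibbs and Young inequalities, and their consequences for the divergence\<close>

text \<open>This is \<open>ln t \<le> t - 1\<close> at \<open>t = b / a\<close>, with the positive
  and negative parts of the logarithm on opposite sides. All terms are nonnegative, so it can be
  integrated without subtraction.\<close>

lemma log_plus_gibbs:
  assumes "0 \<le> a" "0 < b"
  shows "a * log_plus (b / a) + a \<le> a * log_plus (a / b) + b"
proof (cases "a = 0")
  case False
  then have a: "a > 0" using assms by simp
  have "a * ln (b / a) \<le> a * (b / a - 1)"
    using a assms by (intro mult_left_mono ln_le_minus_one) auto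
  then have "a * ln b - a * ln a \<le> b - a"
    using a assms by (simp add: ln_div algebra_simps)
  then show ?thesis
    using a assms by (simp add: log_plus_def ln_div max_def algebra_simps)
qed (use assms in simp)

text \<open>The Fenchel--Young inequality for \<open>t ln t\<close> at \<open>t = a / b\<close>; it avoids any appeal to the
  entropy of the density, which may be infinite.\<close>

lemma log_plus_fenchel:
  assumes "0 \<le> a" "0 < b" "0 \<le> s"
  shows "a * s \<le> a * log_plus (a / b) + b * exp s"
proof (cases "a = 0")
  case False
  then have a: "a > 0" using assms by simp
  \<comment> \<open>Chosen so that \<open>a * exp u = b * exp s\<close>; the claim then reduces to
    \<open>u \<le> exp u\<close>.\<close>
  define u where "u = s - ln (a / b)"
  have "a * u \<le> a * exp u"
    using a exp_ge_add_one_self[of u] by (intro mult_left_mono) linarith+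
  also have "a * exp u = b * exp s"
    using a assms by (simp add: u_def exp_diff)
  finally have "a * s \<le> a * ln (a / b) + b * exp s"
    by (simp add: u_def algebra_simps)
  moreover have "a * ln (a / b) \<le> a * log_plus (a / b)"
    using a assms by (intro mult_left_mono) (auto simp: log_plus_def)
  ultimately show ?thesis by linarith
qed (use assms in simp)

text \<open>Since \<open>ln t \<le> t\<close>, the integrand is at most \<open>g\<close>, which has
  mass 1. Hence the subtracted part of the divergence cannot offset an infinite positive
  part.\<close>

lemma KL_gmm_neg_part_finite:
  assumes f: "prob_density f" and g: "is_gmm g"
  shows "(\<integral>\<^sup>+x. ennreal (f x * log_plus (g x / f x)) \<partial>lborel) \<le> 1"
proof -
  have "f x * log_plus (g x / f x) \<le> g x" for x
  proof (cases "f x > 0")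
    case True
    have "log_plus (g x / f x) \<le> g x / f x"
      using True is_gmm_pos[OF g, of x] ln_le_minus_one[of "g x / f x"]
      by (auto simp: log_plus_def)
    then show ?thesis using True by (simp add: field_simps)
  next
    case False
    then have "f x = 0"
      using f by (auto simp: prob_density_def not_less intro: antisym)
    then show ?thesis
      using is_gmm_pos[OF g, of x] by simp
  qed
  then have "(\<integral>\<^sup>+x. ennreal (f x * log_plus (g x / f x)) \<partial>lborel) \<le> (\<integral>\<^sup>+x. ennreal (g x) \<partial>lborel)"
    by (intro nn_integral_mono ennreal_leI)
  then show ?thesis by (simp add: nn_integral_is_gmm[OF g])
qed

text \<open>Integrating \<open>log_plus_gibbs\<close> adds the mass of \<open>f\<close> on one side
  and of \<open>g\<close> on the other; both are exactly 1 and cancel.\<close>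

lemma KL_gmm_parts_le:
  assumes f: "prob_density f" and g: "is_gmm g"
  shows "(\<integral>\<^sup>+x. ennreal (f x * log_plus (g x / f x)) \<partial>lborel)
       \<le> (\<integral>\<^sup>+x. ennreal (f x * log_plus (f x / g x)) \<partial>lborel)" (is "?N \<le> ?P")
proof -
  have [measurable]: "f \<in> borel_measurable borel" "g \<in> borel_measurable borel"
    and f0: "\<And>x. 0 \<le> f x" and f1: "(\<integral>\<^sup>+x. ennreal (f x) \<partial>lborel) = 1"
    using f is_gmm_measurable[OF g] by (auto simp: prob_density_def)
  have g0: "0 < g x" for x
    using is_gmm_pos[OF g] .
  have "?N + 1 = (\<integral>\<^sup>+x. ennreal (f x * log_plus (g x / f x)) + ennreal (f x) \<partial>lborel)"
    using f1 by (simp add: nn_integral_add)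
  also have "\<dots> \<le> (\<integral>\<^sup>+x. ennreal (f x * log_plus (f x / g x)) + ennreal (g x) \<partial>lborel)"
    using log_plus_gibbs[OF f0 g0] f0 g0
    by (intro nn_integral_mono)
      (simp add: log_plus_nonneg less_imp_le ennreal_leI flip: ennreal_plus)
  also have "\<dots> = ?P + 1"
    using nn_integral_is_gmm[OF g] by (simp add: nn_integral_add)
  finally show ?thesis
    by (simp add: add.commute[of _ 1] ennreal_add_left_cancel_le)
qed

lemma KL_gmm_nonneg:
  assumes "prob_density f" "is_gmm g"
  shows "0 \<le> KL f g"
  unfolding KL_gmm_eq[OF assms] using KL_gmm_parts_le[OF assms]
  by (intro ereal_diff_positive) (simp add: less_eq_ennreal.rep_eq)

lemma KL_gmm_le_pos_part:
  assumes "prob_density f" "is_gmm g"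
  shows "KL f g \<le> enn2ereal (\<integral>\<^sup>+x. ennreal (f x * log_plus (f x / g x)) \<partial>lborel)"
  unfolding KL_gmm_eq[OF assms]
  by (rule ereal_diff_le_self) simp

lemma KL_gmm_pos_part_finite:
  assumes "prob_density f" "is_gmm g" and "KL f g < \<infinity>"
  shows "(\<integral>\<^sup>+x. ennreal (f x * log_plus (f x / g x)) \<partial>lborel) < \<infinity>" (is "?P < _")
proof (rule ccontr)
  let ?N = "\<integral>\<^sup>+x. ennreal (f x * log_plus (g x / f x)) \<partial>lborel"
  assume "\<not> ?P < \<infinity>"
  then have "?P = \<infinity>"
    by (simp add: less_top[symmetric])
  moreover have "?N < \<infinity>"
    using KL_gmm_neg_part_finite[OF assms(1,2)] by (rule le_less_trans) simp
  then have "enn2ereal ?N \<noteq> \<infinity>"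
    by (cases ?N) auto
  ultimately have "KL f g = \<infinity>"
    unfolding KL_gmm_eq[OF assms(1,2)] by simp
  with assms(3) show False by simp
qed

lemma second_moment_finite_if_KL_finite:
  assumes f: "prob_density f" and g: "is_gmm g" and KL: "KL f g < \<infinity>"
  shows "(\<integral>\<^sup>+x. ennreal ((norm x)\<^sup>2 * f x) \<partial>lborel) < \<infinity>"
proof -
  have [measurable]: "f \<in> borel_measurable borel" "g \<in> borel_measurable borel"
    and f0: "\<And>x. 0 \<le> f x"
    using f is_gmm_measurable[OF g] by (auto simp: prob_density_def)
  have g0: "0 < g x" for x
    using is_gmm_pos[OF g] .
  obtain \<epsilon> where \<epsilon>: "\<epsilon> > 0" "(\<integral>\<^sup>+x. ennreal (g x * exp (\<epsilon> * (norm x)\<^sup>2)) \<partial>lborel) < \<infinity>"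
    using is_gmm_exp_moment[OF g] .
  \<comment> \<open>\<open>log_plus_fenchel\<close> at
    \<open>s = \<epsilon> * (norm x)\<^sup>2\<close>, divided by \<epsilon>. Both terms on the right
    have finite integrals.\<close>
  have "ennreal ((norm x)\<^sup>2 * f x) \<le> ennreal (1 / \<epsilon>) *
      (ennreal (f x * log_plus (f x / g x)) + ennreal (g x * exp (\<epsilon> * (norm x)\<^sup>2)))" for x
  proof -
    have "(norm x)\<^sup>2 * f x = 1 / \<epsilon> * (f x * (\<epsilon> * (norm x)\<^sup>2))"
      using \<epsilon>(1) by simp
    also have "\<dots> \<le> 1 / \<epsilon> * (f x * log_plus (f x / g x) + g x * exp (\<epsilon> * (norm x)\<^sup>2))"
      using \<epsilon>(1) f0 g0 by (intro mult_left_mono log_plus_fenchel) auto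
    finally show ?thesis
      using \<epsilon>(1) f0[of x] g0[of x]
      by (simp add: log_plus_nonneg ennreal_leI flip: ennreal_plus ennreal_mult)
  qed
  then have "(\<integral>\<^sup>+x. ennreal ((norm x)\<^sup>2 * f x) \<partial>lborel)
      \<le> (\<integral>\<^sup>+x. ennreal (1 / \<epsilon>) * (ennreal (f x * log_plus (f x / g x))
            + ennreal (g x * exp (\<epsilon> * (norm x)\<^sup>2))) \<partial>lborel)"
    by (intro nn_integral_mono)
  also have "\<dots> = ennreal (1 / \<epsilon>) * ((\<integral>\<^sup>+x. ennreal (f x * log_plus (f x / g x)) \<partial>lborel)
            + (\<integral>\<^sup>+x. ennreal (g x * exp (\<epsilon> * (norm x)\<^sup>2)) \<partial>lborel))"
    by (simp add: nn_integral_cmult nn_integral_add)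
  also have "\<dots> < \<infinity>"
    using KL_gmm_pos_part_finite[OF f g KL] \<epsilon>(2) by (simp add: ennreal_mult_less_top)
  finally show ?thesis .
qed

section \<open>Vitali convergence and the vanishing infimum\<close>

text \<open>Truncate at a level \<open>c\<close>: the truncated part vanishes by dominated
  convergence, constants being integrable over a finite measure, while uniform integrability bounds
  the excess for all \<open>m\<close> at once.\<close>

lemma (in finite_measure) unif_integrable_tendsto_zero:
  assumes [measurable]: "\<And>m. X m \<in> borel_measurable M"
    and lim: "AE x in M. (\<lambda>m. X m x) \<longlonglongrightarrow> 0" and ui: "unif_integrable M X"
  shows "(\<lambda>m. \<integral>\<^sup>+x. ennreal (X m x) \<partial>M) \<longlonglongrightarrow> 0"
proof (rule order_tendstoI)
  fix e :: ennreal assume "0 < e"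
  define s where "s c = (SUP m. \<integral>\<^sup>+x. ennreal (X m x) * indicator {y. X m y > c} x \<partial>M)" for c
  have "eventually (\<lambda>c. s c < e) at_top"
    using order_tendstoD(2)[OF ui[unfolded unif_integrable_def] \<open>0 < e\<close>] by (simp only: s_def)
  then have "eventually (\<lambda>c. s c < e \<and> 0 \<le> c) at_top"
    using eventually_ge_at_top[of 0] by eventually_elim simp
  then obtain c where c: "s c < e" "0 \<le> c"
    using eventually_happens'[OF trivial_limit_at_top_linorder] by blast
  have "(\<lambda>m. \<integral>\<^sup>+x. ennreal (min (X m x) c) \<partial>M) \<longlonglongrightarrow> (\<integral>\<^sup>+x. 0 \<partial>M)"
  proof (rule nn_integral_dominated_convergence[where w = "\<lambda>_. ennreal c"])
    show "(\<integral>\<^sup>+x. ennreal c \<partial>M) < \<infinity>"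
      by (simp add: ennreal_mult_eq_top_iff less_top[symmetric])
    show "AE x in M. (\<lambda>m. ennreal (min (X m x) c)) \<longlonglongrightarrow> 0"
      using lim
    proof eventually_elim
      case (elim x)
      then have "(\<lambda>m. ennreal (min (X m x) c)) \<longlonglongrightarrow> ennreal (min 0 c)"
        by (intro tendsto_intros)
      with c(2) show ?case by simp
    qed
  qed (auto intro!: AE_I2 ennreal_leI)
  then have "(\<lambda>m. (\<integral>\<^sup>+x. ennreal (min (X m x) c) \<partial>M) + s c) \<longlonglongrightarrow> 0 + s c"
    by (intro tendsto_add) auto
  \<comment> \<open>The limit is \<open>s c\<close>, which is strictly below
    \<open>e\<close>.\<close>
  then have "eventually (\<lambda>m. (\<integral>\<^sup>+x. ennreal (min (X m x) c) \<partial>M) + s c < e) sequentially"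
    using c(1) by (intro order_tendstoD) auto
  then show "eventually (\<lambda>m. (\<integral>\<^sup>+x. ennreal (X m x) \<partial>M) < e) sequentially"
  proof eventually_elim
    case (elim m)
    \<comment> \<open>Where \<open>X m x\<close> exceeds \<open>c\<close>, the tail term alone
      dominates it; elsewhere the minimum equals \<open>X m x\<close>.\<close>
    have "(\<integral>\<^sup>+x. ennreal (X m x) \<partial>M)
        \<le> (\<integral>\<^sup>+x. ennreal (min (X m x) c) + ennreal (X m x) * indicator {y. X m y > c} x \<partial>M)"
      by (intro nn_integral_mono) (auto simp: indicator_def min_def)
    also have "\<dots> = (\<integral>\<^sup>+x. ennreal (min (X m x) c) \<partial>M)
        + (\<integral>\<^sup>+x. ennreal (X m x) * indicator {y. X m y > c} x \<partial>M)"
      by (intro nn_integral_add) measurable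
    also have "\<dots> \<le> (\<integral>\<^sup>+x. ennreal (min (X m x) c) \<partial>M) + s c"
      unfolding s_def by (intro add_left_mono SUP_upper) simp
    finally show ?case using elim by simp
  qed
qed simp

text \<open>\<open>log_plus\<close> is defined by cases, but \<open>r m\<close> is eventually
  positive, where it agrees with a function continuous at 1.\<close>

lemma tendsto_log_plus_one:
  assumes "r \<longlonglongrightarrow> 1"
  shows "(\<lambda>m. log_plus (r m)) \<longlonglongrightarrow> 0"
proof -
  have "(\<lambda>m. max (ln (r m)) 0) \<longlonglongrightarrow> max (ln 1) 0"
    using assms by (intro tendsto_intros) auto
  moreover have "eventually (\<lambda>m. r m > 0) sequentially"
    using assms by (rule order_tendstoD) simp
  then have "eventually (\<lambda>m. max (ln (r m)) 0 = log_plus (r m)) sequentially"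
    by eventually_elim (simp add: log_plus_def)
  ultimately show ?thesis
    by (simp add: filterlim_cong)
qed

lemma INF_KL_gmm_eq_zero:
  assumes f: "prob_density f" and g: "\<And>m. is_gmm (g m)"
    and lim: "AE x in dist_of f. (\<lambda>m. f x / g m x) \<longlonglongrightarrow> 1"
    and ui: "unif_integrable (dist_of f) (\<lambda>m x. log_plus (f x / g m x))"
  shows "(INF g\<in>{h. is_gmm h}. KL f g) = 0"
proof (rule antisym)
  have [measurable]: "f \<in> borel_measurable borel" "\<And>m. g m \<in> borel_measurable borel"
    and f0: "\<And>x. 0 \<le> f x" and f1: "(\<integral>\<^sup>+x. ennreal (f x) \<partial>lborel) = 1"
    using f is_gmm_measurable[OF g] by (auto simp: prob_density_def)
  interpret finite_measure "dist_of f"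
    using f1 by (intro finite_measureI) (simp add: emeasure_density)
  have "(\<lambda>m. \<integral>\<^sup>+x. ennreal (log_plus (f x / g m x)) \<partial>dist_of f) \<longlonglongrightarrow> 0"
    using lim ui
    by (intro unif_integrable_tendsto_zero) (auto elim: eventually_mono intro: tendsto_log_plus_one)
  \<comment> \<open>Turns the mean of \<open>L_m\<close> under \<open>F\<close> into the positive
    part of the divergence, which bounds \<open>KL f (g m)\<close> from above.\<close>
  moreover have "(\<integral>\<^sup>+x. ennreal (log_plus (f x / g m x)) \<partial>dist_of f)
      = (\<integral>\<^sup>+x. ennreal (f x * log_plus (f x / g m x)) \<partial>lborel)" for m
    using f0 by (simp add: nn_integral_density log_plus_nonneg ennreal_mult)
  ultimately have "(\<lambda>m. enn2ereal (\<integral>\<^sup>+x. ennreal (f x * log_plus (f x / g m x)) \<partial>lborel)) \<longlonglongrightarrow> enn2ereal 0"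
    by (intro tendsto_enn2erealI) simp
  then show "(INF g\<in>{h. is_gmm h}. KL f g) \<le> 0"
    unfolding zero_ennreal.rep_eq
  proof (rule LIMSEQ_le_const)
    have "(INF g\<in>{h. is_gmm h}. KL f g) \<le> KL f (g m)" for m
      using g by (intro INF_lower) simp
    also have "KL f (g m) \<le> enn2ereal (\<integral>\<^sup>+x. ennreal (f x * log_plus (f x / g m x)) \<partial>lborel)" for m
      by (rule KL_gmm_le_pos_part[OF f g])
    finally show "\<exists>N. \<forall>m\<ge>N. (INF g\<in>{h. is_gmm h}. KL f g)
        \<le> enn2ereal (\<integral>\<^sup>+x. ennreal (f x * log_plus (f x / g m x)) \<partial>lborel)"
      by blast
  qed
  show "0 \<le> (INF g\<in>{h. is_gmm h}. KL f g)"
    using KL_gmm_nonneg[OF f] by (intro INF_greatest) simp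
qed

theorem mainTheorem4:
  fixes \<F> :: "(real^'n \<Rightarrow> real) set"
  assumes dens: "\<forall>f\<in>\<F>. prob_density f"
    and approx: "\<forall>f\<in>\<F>. (\<integral>\<^sup>+ x. ennreal (norm x ^ 2 * f x) \<partial>lborel) < \<infinity> \<longrightarrow>
         (\<exists>g :: nat \<Rightarrow> real^'n \<Rightarrow> real. (\<forall>m. is_gmm (g m))
            \<and> (AE x in dist_of f. (\<lambda>m. f x / g m x) \<longlonglongrightarrow> 1)
            \<and> unif_integrable (dist_of f) (\<lambda>m x. log_plus (f x / g m x)))"
  shows "\<forall>f\<in>\<F>. ((INF g\<in>{h. is_gmm h}. KL f g) = 0
            \<longleftrightarrow> (\<integral>\<^sup>+ x. ennreal (norm x ^ 2 * f x) \<partial>lborel) < \<infinity>)"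
proof (intro ballI iffI)
  fix f assume f: "f \<in> \<F>" and "(INF g\<in>{h. is_gmm h}. KL f g) = 0"
  \<comment> \<open>An infimum below infinity already yields a single mixture with finite
    divergence, and one such mixture bounds the second moment.\<close>
  then have "(INF g\<in>{h. is_gmm h}. KL f g) < \<infinity>"
    by simp
  then obtain g where "is_gmm g" "KL f g < \<infinity>"
    unfolding INF_less_iff by blast
  then show "(\<integral>\<^sup>+ x. ennreal (norm x ^ 2 * f x) \<partial>lborel) < \<infinity>"
    using second_moment_finite_if_KL_finite dens f by blast
next
  fix f assume "f \<in> \<F>" and "(\<integral>\<^sup>+ x. ennreal (norm x ^ 2 * f x) \<partial>lborel) < \<infinity>"
  then show "(INF g\<in>{h. is_gmm h}. KL f g) = 0"
    using dens approx INF_KL_gmm_eq_zero by blast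
qed

end
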